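(* Let $G^c$ be a $2$-edge-coloured multigraph on $n \geq 14$ vertices, coloured with $\{r,b\}$, with $m$ edges. If $rd(G^c)=2$ and $m\geq \binom{n}{2} + \binom{n-3}{2}+4$, then $G^c$ has a proper Hamiltonian path.
   Context: A $c$-edge-coloured multigraph $G^c$ is a multigraph in which every edge receives one colour from $\{1,\ldots,c\}$ and no two parallel edges joining the same pair of vertices have the same colour; $m$ counts all edges. The rainbow degree $rd(x)$ of a vertex $x$ is the number of distinct colours on edges incident to $x$, and $rd(G^c)$ is the minimum of $rd(x)$ over all vertices. A path is proper if any two consecutive edges have different colours; a proper Hamiltonian path is a proper path containing all vertices. *)

theory Defs
  imports Main
begin

text \<open>
  Edges are first-class objects, so that parallel edges are allowed; \<open>ends G e\<close> is the
  unordered pair of end vertices of \<open>e\<close>.  Multigraphs are loopless.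
\<close>

record ('v, 'e, 'c) ec_multigraph =
  vertices :: "'v set"
  edges :: "'e set"
  ends :: "'e \<Rightarrow> 'v set"
  colour :: "'e \<Rightarrow> 'c"

locale edge_coloured_multigraph =
  fixes G :: "('v, 'e, 'c) ec_multigraph" (structure)
    and C :: "'c set"
  assumes finite_vertices: "finite (vertices G)"
    and finite_edges: "finite (edges G)"
    and finite_colours: "finite C"
    and ends_subset: "e \<in> edges G \<Longrightarrow> ends G e \<subseteq> vertices G"
    and card_ends: "e \<in> edges G \<Longrightarrow> card (ends G e) = 2"
    and colour_in: "e \<in> edges G \<Longrightarrow> colour G e \<in> C"
    and parallel_colours: "\<lbrakk>e \<in> edges G; f \<in> edges G; e \<noteq> f; ends G e = ends G f\<rbrakk>
      \<Longrightarrow> colour G e \<noteq> colour G f"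

definition rainbow_degree :: "('v, 'e, 'c) ec_multigraph \<Rightarrow> 'v \<Rightarrow> nat" where
  "rainbow_degree G x = card (colour G ` {e \<in> edges G. x \<in> ends G e})"

definition min_rainbow_degree :: "('v, 'e, 'c) ec_multigraph \<Rightarrow> nat" where
  "min_rainbow_degree G = Min (rainbow_degree G ` vertices G)"

text \<open>
  A path is given by its sequence \<open>vs\<close> of distinct vertices together with the sequence \<open>es\<close>
  of edges it uses, as parallel edges make the vertex sequence alone ambiguous.
\<close>

definition is_path :: "('v, 'e, 'c) ec_multigraph \<Rightarrow> 'v list \<Rightarrow> 'e list \<Rightarrow> bool" where
  "is_path G vs es \<longleftrightarrow>
     length vs = Suc (length es) \<and> distinct vs \<and>
     set vs \<subseteq> vertices G \<and> set es \<subseteq> edges G \<and>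
     (\<forall>i < length es. ends G (es ! i) = {vs ! i, vs ! Suc i})"

definition proper_path :: "('v, 'e, 'c) ec_multigraph \<Rightarrow> 'v list \<Rightarrow> 'e list \<Rightarrow> bool" where
  "proper_path G vs es \<longleftrightarrow> is_path G vs es \<and>
     (\<forall>i. Suc i < length es \<longrightarrow> colour G (es ! i) \<noteq> colour G (es ! Suc i))"

definition has_proper_hamiltonian_path :: "('v, 'e, 'c) ec_multigraph \<Rightarrow> bool" where
  "has_proper_hamiltonian_path G \<longleftrightarrow>
     (\<exists>vs es. proper_path G vs es \<and> set vs = vertices G)"

end

theory Submission
  imports Defs "HOL-Combinatorics.Permutations"
begin

text \<open>
  Write \<open>c\<close> and \<open>d\<close> for the two colour classes as simple graphs, and let \<open>M\<close> be the number of
  pairs missing in \<open>c\<close> plus the number missing in \<open>d\<close>; the hypothesis says \<open>M \<le> 3 n - 10\<close>.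
  Two tools drive the argument.

  Averaging: for even \<open>n\<close> a uniformly random cyclic order whose slots are alternately coloured
  misses \<open>M / (n - 1)\<close> edges in expectation.  Hence there is a Hamiltonian alternating path if
  \<open>M \<le> 2 n - 3\<close> (one defect may be cut), and a Hamiltonian alternating cycle if \<open>M < n - 1\<close>; for
  odd \<open>n\<close> the cycle is used after deleting a vertex that lies on many missing pairs.

  Contraction: a \<open>c\<close>-edge \<open>u x\<close> followed by a \<open>d\<close>-edge \<open>x y\<close> is replaced by one vertex having the
  \<open>c\<close>-neighbours of \<open>y\<close> and the \<open>d\<close>-neighbours of \<open>u\<close>.  This lowers \<open>n\<close> by 2 and \<open>M\<close> by the number
  of missing pairs at \<open>u\<close> in \<open>c\<close>, at \<open>x\<close> in both colours and at \<open>y\<close> in \<open>d\<close>.  If some contraction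
  lowers \<open>M\<close> so much that the graph falls under the bound of about \<open>2 n\<close> that needs no degree
  condition, we are done.  Otherwise no vertex has small degree, so (one case apart) every contraction
  preserves the degree condition, and one around a vertex on the most missing pairs lowers \<open>M\<close> enough
  for the induction.  For odd \<open>n < 15\<close> the induction runs through smaller bounds than \<open>3 n - 10\<close>,
  because there the extremal graphs with a large independent set in one colour take over.
\<close>

subsection \<open>Missing edges, codegrees and alternating lists\<close>

text \<open>Colour classes are not restricted to \<open>V\<close>; only pairs inside
  \<open>V\<close> are consulted, so a vertex is deleted by shrinking \<open>V\<close>
  alone.\<close>

definition nonadj :: "'a set set \<Rightarrow> 'a set \<Rightarrow> 'a \<Rightarrow> 'a set" where
  "nonadj c V v = {z \<in> V - {v}. {v, z} \<notin> c}"

definition codeg :: "'a set set \<Rightarrow> 'a set \<Rightarrow> 'a \<Rightarrow> nat" where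
  "codeg c V v = card (nonadj c V v)"

definition missing :: "'a set set \<Rightarrow> 'a set \<Rightarrow> 'a set set" where
  "missing c V = {e. e \<subseteq> V \<and> card e = 2 \<and> e \<notin> c}"

definition miss2 :: "'a set set \<Rightarrow> 'a set set \<Rightarrow> 'a set \<Rightarrow> nat" where
  "miss2 c d V = card (missing c V) + card (missing d V)"

definition codeg2 :: "'a set set \<Rightarrow> 'a set set \<Rightarrow> 'a set \<Rightarrow> 'a \<Rightarrow> nat" where
  "codeg2 c d V v = codeg c V v + codeg d V v"

definition no_isolated :: "'a set set \<Rightarrow> 'a set \<Rightarrow> bool" where
  "no_isolated c V \<longleftrightarrow> (\<forall>v\<in>V. \<exists>z\<in>V - {v}. {v, z} \<in> c)"

fun alt :: "'a set set \<Rightarrow> 'a set set \<Rightarrow> 'a list \<Rightarrow> bool" where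
  "alt c d (x # y # zs) \<longleftrightarrow> {x, y} \<in> c \<and> alt d c (y # zs)"
| "alt c d _ \<longleftrightarrow> True"

definition ham :: "'a set set \<Rightarrow> 'a set set \<Rightarrow> 'a set \<Rightarrow> bool" where
  "ham c d V \<longleftrightarrow> (\<exists>xs. distinct xs \<and> set xs = V \<and> (alt c d xs \<or> alt d c xs))"

lemma finite_nonadj: "finite V \<Longrightarrow> finite (nonadj c V v)"
  by (simp add: nonadj_def)

lemma finite_missing: "finite V \<Longrightarrow> finite (missing c V)"
  by (rule finite_subset[of _ "Pow V"]) (auto simp: missing_def)

lemma card_missing_remove:
  assumes "finite V" "v \<in> V"
  shows "card (missing c V) = card (missing c (V - {v})) + codeg c V v"
proof -
  have eq: "missing c V = missing c (V - {v}) \<union> (\<lambda>z. {v, z}) ` nonadj c V v"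
    using assms by (auto simp: missing_def nonadj_def card_2_iff doubleton_eq_iff insert_commute)
  have "card ((\<lambda>z. {v, z}) ` nonadj c V v) = codeg c V v"
    unfolding codeg_def by (rule card_image) (auto simp: inj_on_def doubleton_eq_iff)
  moreover have "missing c (V - {v}) \<inter> (\<lambda>z. {v, z}) ` nonadj c V v = {}"
    by (auto simp: missing_def)
  ultimately show ?thesis
    unfolding eq using assms by (subst card_Un_disjoint) (auto simp: finite_missing finite_nonadj)
qed

lemma miss2_remove:
  "finite V \<Longrightarrow> v \<in> V \<Longrightarrow> miss2 c d V = miss2 c d (V - {v}) + codeg2 c d V v"
  using card_missing_remove[of V v c] card_missing_remove[of V v d]
  by (simp add: miss2_def codeg2_def)

lemma codeg_remove_adj: "{v, w} \<in> c \<Longrightarrow> codeg c (V - {w}) v = codeg c V v"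
  unfolding codeg_def nonadj_def by (rule arg_cong[where f = card]) auto

lemma codeg_remove_nonadj:
  assumes "finite V" "w \<in> V" "w \<noteq> v" "{v, w} \<notin> c"
  shows "codeg c V v = Suc (codeg c (V - {w}) v)"
proof -
  have "nonadj c V v = insert w (nonadj c (V - {w}) v)"
    using assms by (auto simp: nonadj_def)
  then show ?thesis
    using assms by (simp add: codeg_def finite_nonadj) (simp add: nonadj_def)
qed

lemma sum_codeg: "finite V \<Longrightarrow> (\<Sum>v\<in>V. codeg c V v) = 2 * card (missing c V)"
proof (induction V rule: finite_induct)
  case empty
  then show ?case by (auto simp: missing_def)
next
  case (insert w V)
  have *: "codeg c (insert w V) v = codeg c V v + (if {v, w} \<notin> c then 1 else 0)" if "v \<in> V" for v
  proof -
    have [simp]: "insert w V - {w} = V" using insert by auto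
    show ?thesis
      using codeg_remove_nonadj[of "insert w V" w v c] codeg_remove_adj[of v w c "insert w V"] insert that
      by (cases "{v, w} \<in> c") auto
  qed
  have "(\<Sum>v\<in>V. if {v, w} \<notin> c then 1 else 0::nat) = card {v\<in>V. {v, w} \<notin> c}"
    using insert by (simp add: sum.If_cases Int_def)
  also have "{v\<in>V. {v, w} \<notin> c} = nonadj c (insert w V) w"
    using insert by (auto simp: nonadj_def insert_commute)
  finally have "(\<Sum>v\<in>V. codeg c (insert w V) v) = 2 * card (missing c V) + codeg c (insert w V) w"
    using * insert by (simp add: sum.distrib codeg_def)
  moreover have "card (missing c (insert w V)) = card (missing c V) + codeg c (insert w V) w"
    using card_missing_remove[of "insert w V" w c] insert by simp
  ultimately show ?case using insert by simp
qed

lemma sum_codeg2: "finite V \<Longrightarrow> (\<Sum>v\<in>V. codeg2 c d V v) = 2 * miss2 c d V"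
  by (simp add: codeg2_def miss2_def sum.distrib sum_codeg)

lemma obtain_neighbour:
  assumes "finite V" "finite X" "v \<in> V" "codeg c V v + card (insert v X) < card V"
  obtains z where "z \<in> V" "z \<notin> X" "z \<noteq> v" "{v, z} \<in> c"
proof -
  have "card (nonadj c V v \<union> insert v X) < card V"
    using card_Un_le[of "nonadj c V v" "insert v X"] assms by (simp add: codeg_def)
  then have "\<not> V \<subseteq> nonadj c V v \<union> insert v X"
    using assms by (meson card_mono finite_UnI finite_insert finite_nonadj leD)
  then show ?thesis using that by (auto simp: nonadj_def)
qed

lemma alt_Cons: "alt c d (x # ys) \<longleftrightarrow> (ys \<noteq> [] \<longrightarrow> {x, hd ys} \<in> c) \<and> alt d c ys"
  by (cases ys) auto

lemma alt_append:
  "alt p q (xs @ ys) \<longleftrightarrow> alt p q xs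
     \<and> (if even (length xs) then alt p q ys else alt q p ys)
     \<and> (xs \<noteq> [] \<longrightarrow> ys \<noteq> [] \<longrightarrow> {last xs, hd ys} \<in> (if odd (length xs) then p else q))"
proof (induction p q xs rule: alt.induct)
  case (1 c d x y zs)
  then show ?case by auto
next
  case ("2_1" c d)
  then show ?case by simp
next
  case ("2_2" c d v)
  then show ?case by (cases ys) auto
qed

lemma alt_nth:
  "alt p q xs \<longleftrightarrow> (\<forall>i. Suc i < length xs \<longrightarrow> {xs ! i, xs ! Suc i} \<in> (if even i then p else q))"
proof (induction p q xs rule: alt.induct)
  case (1 c d x y zs)
  have all_nat: "(\<forall>i. P i) \<longleftrightarrow> P 0 \<and> (\<forall>i. P (Suc i))" for P :: "nat \<Rightarrow> bool"
    by (metis nat.exhaust)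
  show ?case unfolding alt.simps 1
    by (subst (2) all_nat) auto
qed auto

lemma alt_mono:
  "alt p q xs \<Longrightarrow> (\<And>e. e \<subseteq> set xs \<Longrightarrow> e \<in> p \<Longrightarrow> e \<in> p') \<Longrightarrow> (\<And>e. e \<subseteq> set xs \<Longrightarrow> e \<in> q \<Longrightarrow> e \<in> q')
    \<Longrightarrow> alt p' q' xs"
  by (auto simp: alt_nth)

lemma ham_commute: "ham c d V \<longleftrightarrow> ham d c V"
  by (auto simp: ham_def)

lemma miss2_commute: "miss2 c d V = miss2 d c V"
  by (simp add: miss2_def)

lemma codeg2_commute: "codeg2 c d V v = codeg2 d c V v"
  by (simp add: codeg2_def)

subsection \<open>Random alternating cyclic orders\<close>

text \<open>The first transposition moves \<open>a\<close> to \<open>a'\<close>; the second moves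
  the image of \<open>b\<close> to \<open>b'\<close> and fixes \<open>a'\<close>, which differs from
  both.\<close>

lemma ex_permutation_moving_pair:
  assumes "a \<in> V" "b \<in> V" "a' \<in> V" "b' \<in> V" "a \<noteq> b" "a' \<noteq> b'"
  obtains \<sigma> where "\<sigma> permutes V" "\<sigma> a = a'" "\<sigma> b = b'"
proof
  let ?b = "transpose a a' b"
  have "?b \<in> V" "?b \<noteq> a'"
    using assms by (auto simp: transpose_def)
  then show "transpose ?b b' \<circ> transpose a a' permutes V"
    using assms by (intro permutes_compose permutes_swap_id)
  show "(transpose ?b b' \<circ> transpose a a') a = a'" "(transpose ?b b' \<circ> transpose a a') b = b'"
    using assms \<open>?b \<noteq> a'\<close> by auto
qed

text \<open>Composing with a permutation that moves one pair to another shows that all ordered pairs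
  give the same sum. After summing over the pairs and exchanging, each permutation merely rearranges
  the pairs.\<close>

lemma sum_permutations_pair:
  fixes g :: "'a \<Rightarrow> 'a \<Rightarrow> nat"
  assumes V: "finite V" and ab: "a \<in> V" "b \<in> V" "a \<noteq> b"
  shows "card V * (card V - 1) * (\<Sum>\<pi> | \<pi> permutes V. g (\<pi> a) (\<pi> b))
    = fact (card V) * (\<Sum>x\<in>V. \<Sum>y\<in>V - {x}. g x y)"
proof -
  let ?P = "{\<pi>. \<pi> permutes V}"
  let ?S = "\<lambda>a b. \<Sum>\<pi>\<in>?P. g (\<pi> a) (\<pi> b)"
  have const: "?S a' b' = ?S a b" if "a' \<in> V" "b' \<in> V - {a'}" for a' b'
  proof -
    obtain \<sigma> where \<sigma>: "\<sigma> permutes V" "\<sigma> a = a'" "\<sigma> b = b'"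
      using ex_permutation_moving_pair[of a V b a' b'] ab \<open>a' \<in> V\<close> \<open>b' \<in> V - {a'}\<close> by auto
    have "?S a b = (\<Sum>\<pi>\<in>?P. g ((\<pi> \<circ> \<sigma>) a) ((\<pi> \<circ> \<sigma>) b))"
      by (rule sum_permutations_compose_right[OF \<sigma>(1)])
    then show ?thesis by (simp add: \<sigma>)
  qed
  have perm: "(\<Sum>x\<in>V. \<Sum>y\<in>V - {x}. g (\<pi> x) (\<pi> y)) = (\<Sum>x\<in>V. \<Sum>y\<in>V - {x}. g x y)"
    if "\<pi> permutes V" for \<pi>
  proof -
    have "(\<Sum>y\<in>V - {x}. g (\<pi> x) (\<pi> y)) = (\<Sum>y\<in>V - {\<pi> x}. g (\<pi> x) y)" if "x \<in> V" for x
    proof (rule sum.reindex_bij_betw)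
      show "bij_betw \<pi> (V - {x}) (V - {\<pi> x})"
        using permutes_imp_bij[OF \<open>\<pi> permutes V\<close>] \<open>x \<in> V\<close>
        by (intro bij_betw_DiffI) (auto simp: bij_betw_def)
    qed
    then show ?thesis
      using sum.reindex_bij_betw[OF permutes_imp_bij[OF that], of "\<lambda>x. \<Sum>y\<in>V - {x}. g x y"] by simp
  qed
  have "card V * (card V - 1) * ?S a b = (\<Sum>x\<in>V. \<Sum>y\<in>V - {x}. ?S a b)"
    by simp
  also have "\<dots> = (\<Sum>x\<in>V. \<Sum>y\<in>V - {x}. ?S x y)"
    by (rule sum.cong[OF refl], rule sum.cong[OF refl]) (simp add: const)
  also have "\<dots> = (\<Sum>\<pi>\<in>?P. \<Sum>x\<in>V. \<Sum>y\<in>V - {x}. g (\<pi> x) (\<pi> y))"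
    by (subst (2) sum.swap, subst sum.swap) simp
  also have "\<dots> = fact (card V) * (\<Sum>x\<in>V. \<Sum>y\<in>V - {x}. g x y)"
    using perm by (simp add: card_permutations[OF refl V])
  finally show ?thesis .
qed

lemma sum_missing_pairs:
  assumes "finite V"
  shows "(\<Sum>x\<in>V. \<Sum>y\<in>V - {x}. of_bool ({x, y} \<notin> c) :: nat) = 2 * card (missing c V)"
proof -
  have "(\<Sum>y\<in>V - {x}. of_bool ({x, y} \<notin> c) :: nat) = codeg c V x" for x
    using assms by (simp add: codeg_def nonadj_def sum.If_cases of_bool_def Int_def)
  then show ?thesis using sum_codeg[OF assms] by simp
qed

lemma card_even_lessThan: "even N \<Longrightarrow> card {i. i < N \<and> even i} = N div 2"
proof -
  assume "even N"
  then have "{i. i < N \<and> even i} = (\<lambda>k. 2 * k) ` {..<N div 2}"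
    by (auto elim!: evenE)
  then show ?thesis by (simp add: card_image inj_on_def)
qed

text \<open>
  In a uniformly random cyclic order with colours alternating along the slots, each missing
  edge is hit with probability \<open>1 / (card V - 1)\<close>.
\<close>

lemma ex_cyclic_order_few_defects:
  assumes V: "finite V" "even (card V)" "V \<noteq> {}"
  obtains h where "bij_betw h {..<card V} V"
    "(card V - 1) * card {i. i < card V \<and> {h i, h (Suc i mod card V)} \<notin> (if even i then c else d)}
       \<le> miss2 c d V"
proof -
  define N where "N = card V"
  have N: "even N" "N \<ge> 2"
    using V unfolding N_def by (auto simp: card_gt_0_iff Suc_le_eq elim!: evenE)
  let ?P = "{\<pi>. \<pi> permutes V}"
  obtain e where e: "bij_betw e {..<N} V"
    using ex_bij_betw_nat_finite[OF V(1)] by (auto simp: N_def atLeast0LessThan)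
  define bad where "bad \<pi> i \<longleftrightarrow>
    {\<pi> (e i), \<pi> (e (Suc i mod N))} \<notin> (if even i then c else d)" for \<pi> i
  define col where "col i = (if even i then c else d)" for i :: nat
  have slot: "N * (N - 1) * (\<Sum>\<pi>\<in>?P. of_bool (bad \<pi> i)) = fact N * (2 * card (missing (col i) V))"
    if "i < N" for i
  proof -
    have ne: "i \<noteq> Suc i mod N" using that N by (cases "Suc i = N") auto
    have lt: "Suc i mod N < N" using N by auto
    have "e i \<in> V" "e (Suc i mod N) \<in> V" "e i \<noteq> e (Suc i mod N)"
      using e that lt ne by (auto simp: bij_betw_def inj_on_def)
    from sum_permutations_pair[OF V(1) this, of "\<lambda>x y. of_bool ({x, y} \<notin> col i)"]
    show ?thesis unfolding sum_missing_pairs[OF V(1)] bad_def col_def N_def .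
  qed
  have cards: "card {i. i < N \<and> even i} = N div 2" "card {i. i < N \<and> odd i} = N div 2"
  proof -
    show 1: "card {i. i < N \<and> even i} = N div 2" using N by (simp add: card_even_lessThan)
    have "card {i. i < N \<and> odd i} = card ({..<N} - {i. i < N \<and> even i})"
      by (rule arg_cong[where f = card]) auto
    also have "\<dots> = N - N div 2" using 1 by (subst card_Diff_subset) auto
    finally show "card {i. i < N \<and> odd i} = N div 2" using N by auto
  qed
  have "(\<Sum>i<N. card (missing (col i) V)) = N div 2 * miss2 c d V"
  proof -
    have "(\<Sum>i<N. card (missing (col i) V)) =
      (\<Sum>i<N. if even i then card (missing c V) else card (missing d V))"
      by (intro sum.cong) (auto simp: col_def)
    also have "\<dots> = N div 2 * miss2 c d V"
      using cards by (simp add: sum.If_cases Int_def miss2_def algebra_simps)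
    finally show ?thesis .
  qed
  then have "N * (N - 1) * (\<Sum>i<N. \<Sum>\<pi>\<in>?P. of_bool (bad \<pi> i)) = fact N * (2 * (N div 2 * miss2 c d V))"
    unfolding \<open>(\<Sum>i<N. card (missing (col i) V)) = _\<close>[symmetric] sum_distrib_left
    using slot by (simp add: sum_distrib_left)
  also have "\<dots> = N * (fact N * miss2 c d V)"
    using N by auto
  finally have "(N - 1) * (\<Sum>i<N. \<Sum>\<pi>\<in>?P. of_bool (bad \<pi> i)) = fact N * miss2 c d V"
    using N by (simp add: mult.assoc)
  then have total: "(\<Sum>\<pi>\<in>?P. (N - 1) * (\<Sum>i<N. of_bool (bad \<pi> i))) = fact N * miss2 c d V"
    by (subst (asm) sum.swap) (simp add: sum_distrib_left)
  \<comment> \<open>Some permutation does no worse than the average.\<close>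
  have "\<exists>\<pi>. \<pi> permutes V \<and> (N - 1) * (\<Sum>i<N. of_bool (bad \<pi> i)) \<le> miss2 c d V"
  proof (rule ccontr)
    assume "\<not> ?thesis"
    then have "Suc (miss2 c d V) \<le> (N - 1) * (\<Sum>i<N. of_bool (bad \<pi> i))" if "\<pi> permutes V" for \<pi>
      using that not_le Suc_le_eq by blast
    then have "(\<Sum>\<pi>\<in>?P. Suc (miss2 c d V)) \<le> fact N * miss2 c d V"
      unfolding total[symmetric] by (intro sum_mono) simp
    then have "fact N * Suc (miss2 c d V) \<le> fact N * miss2 c d V"
      by (simp add: card_permutations[OF N_def[symmetric] V(1)])
    then show False by simp
  qed
  then obtain \<pi> where \<pi>: "\<pi> permutes V" "(N - 1) * (\<Sum>i<N. of_bool (bad \<pi> i)) \<le> miss2 c d V"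
    by blast
  show thesis
  proof (rule that[of "\<pi> \<circ> e"])
    show "bij_betw (\<pi> \<circ> e) {..<card V} V"
      using e permutes_imp_bij[OF \<pi>(1)] unfolding N_def by (rule bij_betw_trans)
    have "(\<Sum>i<N. of_bool (bad \<pi> i)) = card {i. i < N \<and> bad \<pi> i}"
      by (simp add: of_bool_def sum.If_cases Int_def)
    with \<pi>(2) show "(card V - 1) * card {i. i < card V \<and> {(\<pi> \<circ> e) i, (\<pi> \<circ> e) (Suc i mod card V)}
        \<notin> (if even i then c else d)} \<le> miss2 c d V"
      by (simp add: N_def[symmetric] bad_def)
  qed
qed

section \<open>Paths cut out of a cyclic order\<close>

lemma mod_add_left_inj_nat:
  fixes i j k N :: nat
  assumes "(k + i) mod N = (k + j) mod N" "i < N" "j < N"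
  shows "i = j"
  using assms
proof (induction i j rule: linorder_wlog)
  case (le i j)
  then have "N dvd j - i"
    using mod_eq_dvd_iff_nat[of "k + i" "k + j" N] by simp
  then show ?case using le by (auto dest: dvd_imp_le)
qed auto

lemma list_of_reindexed_bij:
  assumes "bij_betw h {..<N} V" "inj_on f {..<N}" "f ` {..<N} \<subseteq> {..<N}"
  shows "distinct (map (\<lambda>i. h (f i)) [0..<N])" "set (map (\<lambda>i. h (f i)) [0..<N]) = V"
proof -
  have f: "f ` {..<N} = {..<N}"
    using assms by (simp add: card_image card_subset_eq)
  show "set (map (\<lambda>i. h (f i)) [0..<N]) = V"
    using assms(1) f by (simp add: atLeast0LessThan image_image[symmetric] bij_betw_def)
  have "inj_on (h \<circ> f) {..<N}"
    using assms f by (intro comp_inj_on) (simp_all add: bij_betw_def)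
  then show "distinct (map (\<lambda>i. h (f i)) [0..<N])"
    by (simp add: distinct_map atLeast0LessThan comp_def)
qed

definition slot_ok :: "'a set set \<Rightarrow> 'a set set \<Rightarrow> nat \<Rightarrow> (nat \<Rightarrow> 'a) \<Rightarrow> nat \<Rightarrow> bool" where
  "slot_ok c d N h i \<longleftrightarrow> {h i, h (Suc i mod N)} \<in> (if even i then c else d)"

lemma even_mod_iff: "even N \<Longrightarrow> even (a mod N) \<longleftrightarrow> even (a::nat)"
  by (simp add: dvd_mod_iff)

lemma if_not_swap: "(if \<not> P then x else y) = (if P then y else x)"
  by simp

text \<open>From position \<open>k\<close> the path uses every slot except \<open>k - 1\<close>
  modulo \<open>N\<close>, so a defect there is harmless. As \<open>N\<close> is even, colours keep
  alternating across the wrap-around.\<close>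

lemma forward_path:
  assumes h: "bij_betw h {..<N} V" and N: "even N" "N > 0"
    and ok: "\<And>i. Suc i < N \<Longrightarrow> slot_ok c d N h ((k + i) mod N)"
  obtains xs where "distinct xs" "set xs = V" "hd xs = h (k mod N)"
    "if even k then alt c d xs else alt d c xs"
proof
  let ?xs = "map (\<lambda>i. h ((k + i) mod N)) [0..<N]"
  have "inj_on (\<lambda>i. (k + i) mod N) {..<N}" "(\<lambda>i. (k + i) mod N) ` {..<N} \<subseteq> {..<N}"
    using N by (auto intro!: inj_onI dest: mod_add_left_inj_nat)
  then show "distinct ?xs" "set ?xs = V"
    by (rule list_of_reindexed_bij[OF h])+
  show "hd ?xs = h (k mod N)"
    using N by (simp add: hd_map)
  have "{?xs ! i, ?xs ! Suc i} \<in> (if even k = even i then c else d)" if "Suc i < N" for i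
    using ok[OF that] that N by (simp add: slot_ok_def even_mod_iff mod_Suc_eq)
  then show "if even k then alt c d ?xs else alt d c ?xs"
    by (cases "even k") (simp_all add: alt_nth if_not_swap del: if_split)
qed

text \<open>Read backwards from \<open>k\<close>, the path starts with slot \<open>k - 1\<close>,
  whose colour is opposite to that of slot \<open>k\<close>.\<close>

lemma backward_path:
  assumes h: "bij_betw h {..<N} V" and N: "even N" "N > 0"
    and ok: "\<And>i. i < N \<Longrightarrow> slot_ok c d N h i"
  obtains xs where "distinct xs" "set xs = V" "hd xs = h (k mod N)"
    "if even k then alt d c xs else alt c d xs"
proof
  let ?xs = "map (\<lambda>i. h ((k + (N - i)) mod N)) [0..<N]"
  have inj: "i = j" if "(k + (N - i)) mod N = (k + (N - j)) mod N" "i < N" "j < N" for i j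
  proof -
    \<comment> \<open>At \<open>i = 0\<close> the summand \<open>N - i\<close> is \<open>N\<close>,
      too large for \<open>mod_add_left_inj_nat\<close>; shifting by one brings both summands below
      \<open>N\<close>.\<close>
    have "(Suc k + (N - Suc i)) mod N = (Suc k + (N - Suc j)) mod N"
      using that by (simp add: Suc_diff_Suc)
    then have "N - Suc i = N - Suc j"
      using that by (intro mod_add_left_inj_nat[of "Suc k" "N - Suc i" N "N - Suc j"]) auto
    then show ?thesis using that by linarith
  qed
  have "inj_on (\<lambda>i. (k + (N - i)) mod N) {..<N}"
    by (rule inj_onI, rule inj) auto
  moreover have "(\<lambda>i. (k + (N - i)) mod N) ` {..<N} \<subseteq> {..<N}"
    using N by auto
  ultimately show "distinct ?xs" "set ?xs = V"
    by (rule list_of_reindexed_bij[OF h])+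
  show "hd ?xs = h (k mod N)"
    using N by (simp add: hd_map)
  have "{?xs ! i, ?xs ! Suc i} \<in> (if even k \<noteq> even i then c else d)" if "Suc i < N" for i
  proof -
    define a where "a = k + (N - Suc i)"
    have "Suc a = k + (N - i)" using that by (simp add: a_def Suc_diff_Suc)
    moreover have "even a \<longleftrightarrow> odd (k + i)" using that N by (simp add: a_def)
    ultimately show ?thesis
      using ok[of "a mod N"] that N
      by (simp add: slot_ok_def even_mod_iff mod_Suc_eq a_def[symmetric] insert_commute)
  qed
  then show "if even k then alt d c ?xs else alt c d ?xs"
    by (cases "even k") (simp_all add: alt_nth if_not_swap del: if_split)
qed

lemma ham_even:
  assumes V: "finite V" "even (card V)" "V \<noteq> {}" and m: "miss2 c d V \<le> 2 * card V - 3"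
  shows "ham c d V"
proof -
  define N where "N = card V"
  have N: "even N" "N \<ge> 2"
    using V unfolding N_def by (auto simp: card_gt_0_iff Suc_le_eq elim!: evenE)
  obtain h where h: "bij_betw h {..<N} V" and
    le: "(N - 1) * card {i. i < N \<and> \<not> slot_ok c d N h i} \<le> miss2 c d V"
    using ex_cyclic_order_few_defects[OF V, of c d] unfolding N_def slot_ok_def by blast
  have "(N - 1) * card {i. i < N \<and> \<not> slot_ok c d N h i} < (N - 1) * 2"
    using le m N unfolding N_def[symmetric] by linarith
  then have "card {i. i < N \<and> \<not> slot_ok c d N h i} \<le> Suc 0"
    using mult_less_cancel1 by auto
  then have one: "\<And>i j. i < N \<Longrightarrow> \<not> slot_ok c d N h i \<Longrightarrow> j < N \<Longrightarrow> \<not> slot_ok c d N h j \<Longrightarrow> i = j"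
    by (subst (asm) card_le_Suc0_iff_eq) auto
  \<comment> \<open>The cycle is cut at \<open>j\<close>: the only defect, or an arbitrary slot when
    there is none.\<close>
  obtain j where j: "j < N" "\<And>i. i < N \<Longrightarrow> i \<noteq> j \<Longrightarrow> slot_ok c d N h i"
  proof (cases "\<exists>j<N. \<not> slot_ok c d N h j")
    case True
    then show ?thesis using one that by blast
  next
    case False
    then show ?thesis using that[of 0] N by auto
  qed
  have "slot_ok c d N h ((Suc j + i) mod N)" if "Suc i < N" for i
  proof (rule j(2))
    show "(Suc j + i) mod N \<noteq> j"
    proof
      assume "(Suc j + i) mod N = j"
      then have "(j + Suc i) mod N = (j + 0) mod N" using j by simp
      then have "Suc i = 0" by (rule mod_add_left_inj_nat) (use that in auto)
      then show False by simp
    qed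
  qed (use N in auto)
  then obtain xs where "distinct xs" "set xs = V" "if even (Suc j) then alt c d xs else alt d c xs"
    using forward_path[OF h N(1), of c d "Suc j"] N by auto
  then show ?thesis by (auto simp: ham_def split: if_splits)
qed

text \<open>So few missing pairs leave no defect. The cycle can be opened at any \<open>y\<close>,
  and the direction of travel is chosen so that the first edge has colour \<open>c\<close>.\<close>

lemma alt_cycle_from:
  assumes V: "finite V" "even (card V)" "y \<in> V" and m: "miss2 c d V < card V - 1"
  obtains xs where "distinct xs" "set xs = V" "hd xs = y" "alt c d xs"
proof -
  define N where "N = card V"
  have N: "even N" "N > 0"
    using V unfolding N_def by (auto simp: card_gt_0_iff)
  obtain h where h: "bij_betw h {..<N} V" and
    le: "(N - 1) * card {i. i < N \<and> \<not> slot_ok c d N h i} \<le> miss2 c d V"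
    using ex_cyclic_order_few_defects[OF V(1,2), of c d] V unfolding N_def slot_ok_def by blast
  have "(N - 1) * card {i. i < N \<and> \<not> slot_ok c d N h i} < (N - 1) * 1"
    using le m unfolding N_def[symmetric] by linarith
  then have "card {i. i < N \<and> \<not> slot_ok c d N h i} = 0"
    using mult_less_cancel1 by auto
  then have ok: "\<And>i. i < N \<Longrightarrow> slot_ok c d N h i"
    by simp
  obtain k where k: "k < N" "h k = y"
    using h V by (auto simp: bij_betw_def)
  show thesis
  proof (cases "even k")
    case True
    obtain xs where "distinct xs" "set xs = V" "hd xs = h (k mod N)" "if even k then alt c d xs else alt d c xs"
      using forward_path[OF h N, of c d k] ok N by auto
    then show ?thesis using that True k by auto
  next
    case False
    obtain xs where "distinct xs" "set xs = V" "hd xs = h (k mod N)" "if even k then alt d c xs else alt c d xs"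
      using backward_path[OF h N, of c d k] ok by auto
    then show ?thesis using that False k by auto
  qed
qed

text \<open>Deleting \<open>v\<close> leaves an even order and few enough missing pairs for an
  alternating cycle, which is opened at \<open>y\<close> with a \<open>d\<close>-edge; then
  \<open>v\<close> is put in front.\<close>

lemma ham_odd_by_deletion_aux:
  assumes V: "finite V" "odd (card V)" and v: "v \<in> V" "y \<in> V - {v}" "{v, y} \<in> c"
    and m: "miss2 c d V < card V - 2 + codeg2 c d V v"
  shows "ham c d V"
proof -
  have "even (card (V - {v}))" "miss2 d c (V - {v}) < card (V - {v}) - 1"
    using V v m miss2_remove[OF V(1) v(1), of c d] by (auto simp: miss2_commute[of d])
  then obtain xs where xs: "distinct xs" "set xs = V - {v}" "hd xs = y" "alt d c xs"
    using alt_cycle_from[of "V - {v}" y d c] V v by auto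
  have "xs \<noteq> []" using xs(2) v(2) by (metis empty_iff list.set(1))
  then have "alt c d (v # xs)" using v(3) xs(3,4) by (subst alt_Cons) auto
  moreover have "distinct (v # xs)" using xs(1,2) by simp
  moreover have "set (v # xs) = V" using xs(2) v(1) by (simp add: insert_absorb)
  ultimately show ?thesis unfolding ham_def by blast
qed

lemma ham_odd_by_deletion:
  assumes V: "finite V" "odd (card V)" and v: "v \<in> V" "y \<in> V - {v}" "{v, y} \<in> c \<or> {v, y} \<in> d"
    and m: "miss2 c d V < card V - 2 + codeg2 c d V v"
  shows "ham c d V"
  using ham_odd_by_deletion_aux[OF V v(1,2), of c d] ham_odd_by_deletion_aux[OF V v(1,2), of d c] v(3) m
  by (auto simp: ham_commute[of d c] miss2_commute[of d c] codeg2_commute[of d c])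

subsection \<open>Contracting a path of length two\<close>

text \<open>On \<open>V - {u, x}\<close> this is a copy of \<open>d\<close> on
  \<open>V - {x, y}\<close>; taking a preimage lets counts and degrees transfer along a
  bijection.\<close>

definition redirect :: "'a \<Rightarrow> 'a \<Rightarrow> 'a set set \<Rightarrow> 'a set set" where
  "redirect y u d = {e. id(y := u) ` e \<in> d}"

lemma bij_betw_redirect:
  assumes "u \<in> V" "x \<in> V" "y \<in> V" "u \<noteq> x" "x \<noteq> y" "u \<noteq> y"
  shows "bij_betw (id(y := u)) (V - {u, x}) (V - {x, y})"
  unfolding bij_betw_def using assms by (auto simp: inj_on_def image_iff)

lemma card_missing_bij:
  assumes s: "bij_betw s A B"
  shows "card (missing {e. s ` e \<in> d} A) = card (missing d B)"
proof (rule bij_betw_same_card)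
  have inj: "inj_on s A" and img: "s ` A = B" using s by (auto simp: bij_betw_def)
  have card: "card (s ` e) = card e" if "e \<subseteq> A" for e
    using that inj by (meson card_image inj_on_subset)
  have "image s ` missing {e. s ` e \<in> d} A = missing d B"
  proof
    show "image s ` missing {e. s ` e \<in> d} A \<subseteq> missing d B"
      using card img by (auto simp: missing_def)
    show "missing d B \<subseteq> image s ` missing {e. s ` e \<in> d} A"
    proof
      fix f assume f: "f \<in> missing d B"
      then obtain e where "e \<subseteq> A" "f = s ` e"
        unfolding missing_def img[symmetric] by (auto elim: subset_imageE)
      then show "f \<in> image s ` missing {e. s ` e \<in> d} A"
        using f card by (auto simp: missing_def)
    qed
  qed
  moreover have "inj_on (image s) (missing {e. s ` e \<in> d} A)"
    by (rule inj_on_subset[OF inj_on_image_Pow[OF inj]]) (auto simp: missing_def)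
  ultimately show "bij_betw (image s) (missing {e. s ` e \<in> d} A) (missing d B)"
    by (simp add: bij_betw_def)
qed

lemma no_isolated_bij:
  assumes s: "bij_betw s A B" and B: "no_isolated d B"
  shows "no_isolated {e. s ` e \<in> d} A"
  unfolding no_isolated_def
proof
  fix v assume v: "v \<in> A"
  then obtain z where z: "z \<in> B - {s v}" "{s v, z} \<in> d"
    using s B by (auto simp: no_isolated_def bij_betw_def)
  then obtain w where "w \<in> A" "z = s w" using s by (auto simp: bij_betw_def)
  with z show "\<exists>z\<in>A - {v}. {v, z} \<in> {e. s ` e \<in> d}" by auto
qed

definition path3 :: "'a set set \<Rightarrow> 'a set set \<Rightarrow> 'a set \<Rightarrow> 'a \<Rightarrow> 'a \<Rightarrow> 'a \<Rightarrow> bool" where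
  "path3 c d V u x y \<longleftrightarrow> u \<in> V \<and> x \<in> V \<and> y \<in> V \<and> u \<noteq> x \<and> x \<noteq> y \<and> u \<noteq> y \<and> {u, x} \<in> c \<and> {x, y} \<in> d"

definition weight :: "'a set set \<Rightarrow> 'a set set \<Rightarrow> 'a set \<Rightarrow> 'a \<Rightarrow> 'a \<Rightarrow> 'a \<Rightarrow> nat" where
  "weight c d V u x y = codeg c V u + codeg2 c d V x + codeg d V y"

lemma path3_commute: "path3 c d V u x y \<longleftrightarrow> path3 d c V y x u"
  by (auto simp: path3_def insert_commute)

lemma weight_commute: "weight c d V u x y = weight d c V y x u"
  by (simp add: weight_def codeg2_def)

lemma card_contract: "finite V \<Longrightarrow> path3 c d V u x y \<Longrightarrow> card (V - {u, x}) = card V - 2"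
  by (simp add: path3_def card_Diff_subset)

text \<open>Colour \<open>c\<close> loses \<open>u\<close> and \<open>x\<close>; colour
  \<open>d\<close> loses \<open>x\<close> and \<open>y\<close>, up to renaming. As
  \<open>{u, x}\<close> and \<open>{x, y}\<close> are edges of these colours, no missing pair is
  counted twice.\<close>

lemma miss2_contract:
  assumes V: "finite V" and p: "path3 c d V u x y"
  shows "miss2 c d V = miss2 c (redirect y u d) (V - {u, x}) + weight c d V u x y"
proof -
  have two: "card (missing e V) = card (missing e (V - {a, b})) + codeg e V a + codeg e V b"
    if "a \<in> V" "b \<in> V" "a \<noteq> b" "{a, b} \<in> e" for a b e
    using card_missing_remove[of V a e] card_missing_remove[of "V - {a}" b e] that V
      codeg_remove_adj[of b a e V] by (simp add: insert_commute Diff_insert2[symmetric])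
  have "card (missing (redirect y u d) (V - {u, x})) = card (missing d (V - {x, y}))"
    unfolding redirect_def using p
    by (intro card_missing_bij bij_betw_redirect) (auto simp: path3_def)
  then show ?thesis
    using two[of u x c] two[of x y d] p by (auto simp: path3_def miss2_def weight_def codeg2_def)
qed

lemma redirect_iff:
  assumes "y \<notin> e"
  shows "e \<in> redirect y u d \<longleftrightarrow> e \<in> d"
proof -
  have "id(y := u) ` e = e" using assms by (auto simp: image_iff)
  then show ?thesis by (simp add: redirect_def)
qed

lemma redirect_pair: "a \<noteq> y \<Longrightarrow> {a, y} \<in> redirect y u d \<longleftrightarrow> {a, u} \<in> d"
  by (simp add: redirect_def)

lemma alt_redirect:
  assumes "y \<notin> set xs"
  shows "alt c (redirect y u d) xs \<Longrightarrow> alt c d xs" "alt (redirect y u d) c xs \<Longrightarrow> alt d c xs"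
proof -
  have "e \<in> d" if "e \<subseteq> set xs" "e \<in> redirect y u d" for e
    using that assms redirect_iff[of y e u d] by blast
  then show "alt c (redirect y u d) xs \<Longrightarrow> alt c d xs" "alt (redirect y u d) c xs \<Longrightarrow> alt d c xs"
    by (auto elim!: alt_mono)
qed

text \<open>
  In the contracted graph the vertex \<open>y\<close> stands for the path \<open>u x y\<close>, which is traversed
  in the direction that puts the end \<open>u\<close> next to the \<open>d\<close>-edge at \<open>y\<close>.
\<close>

lemma ham_contract:
  assumes p: "path3 c d V u x y" and ham: "ham c (redirect y u d) (V - {u, x})"
  shows "ham c d V"
proof -
  let ?d = "redirect y u d"
  obtain xs where xs: "distinct xs" "set xs = V - {u, x}" "alt c ?d xs \<or> alt ?d c xs"
    using ham by (auto simp: ham_def)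
  have "y \<in> set xs" using p xs by (auto simp: path3_def)
  then obtain as bs where asbs: "xs = as @ y # bs" by (meson split_list)
  have y: "y \<notin> set as" "y \<notin> set bs" using xs asbs by auto
  have ux: "{u, x} \<in> c" "{x, u} \<in> c" "{x, y} \<in> d" "{y, x} \<in> d"
    using p by (auto simp: path3_def insert_commute)
  have last: "{last as, y} \<in> ?d \<longleftrightarrow> {last as, u} \<in> d" if "as \<noteq> []"
    using that y by (intro redirect_pair) (metis last_in_set)
  have hd: "{y, hd bs} \<in> ?d \<longleftrightarrow> {u, hd bs} \<in> d" if "bs \<noteq> []"
    using that y redirect_pair[of "hd bs" y u d] by (metis hd_in_set insert_commute)
  note lift = alt_redirect[OF y(1), where c = c and d = d and u = u]
    alt_redirect[OF y(2), where c = c and d = d and u = u]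
  have d1: "distinct (as @ [u, x, y] @ bs)" "distinct (as @ [y, x, u] @ bs)"
    using xs p unfolding asbs path3_def by auto
  have s1: "set (as @ [u, x, y] @ bs) = V" "set (as @ [y, x, u] @ bs) = V"
    using xs p unfolding asbs path3_def by auto
  have "alt c d (as @ [u, x, y] @ bs) \<or> alt d c (as @ [u, x, y] @ bs)
      \<or> alt c d (as @ [y, x, u] @ bs) \<or> alt d c (as @ [y, x, u] @ bs)"
  proof -
    \<comment> \<open>The starting colour and the parity of \<open>length as\<close> tell on which
      side of \<open>y\<close> the \<open>d\<close>-edge lies; \<open>u\<close> goes to that
      side.\<close>
    consider "alt c ?d xs" "even (length as)" | "alt c ?d xs" "odd (length as)"
      | "alt ?d c xs" "even (length as)" | "alt ?d c xs" "odd (length as)"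
      using xs(3) by blast
    then show ?thesis
    proof cases
      case 1
      then have "alt c d (as @ [u, x, y] @ bs)"
        using lift last ux unfolding asbs by (simp add: alt_append alt_Cons)
      then show ?thesis by blast
    next
      case 2
      then have "alt c d (as @ [y, x, u] @ bs)"
        using lift hd ux unfolding asbs by (simp add: alt_append alt_Cons)
      then show ?thesis by blast
    next
      case 3
      then have "alt d c (as @ [y, x, u] @ bs)"
        using lift hd ux unfolding asbs by (simp add: alt_append alt_Cons)
      then show ?thesis by blast
    next
      case 4
      then have "alt d c (as @ [u, x, y] @ bs)"
        using lift last ux unfolding asbs by (simp add: alt_append alt_Cons)
      then show ?thesis by blast
    qed
  qed
  then show ?thesis using d1 s1 unfolding ham_def by blast
qed

lemma no_isolated_contract:
  assumes p: "path3 c d V u x y"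
    and "no_isolated d (V - {x, y})"
  shows "no_isolated (redirect y u d) (V - {u, x})"
  unfolding redirect_def using assms
  by (intro no_isolated_bij[OF bij_betw_redirect]) (auto simp: path3_def)

text \<open>The degrees of \<open>x\<close> in the two colours sum to at least
  \<open>card V\<close>, so both are positive and one is at least 2. The neighbour in the other
  colour is chosen first and then avoided.\<close>

lemma ex_path3:
  assumes V: "finite V" "card V \<ge> 3" "x \<in> V" and deg: "codeg2 c d V x < card V - 1"
  obtains u y where "path3 c d V u x y"
proof (cases "codeg c V x + 2 < card V")
  case True
  have one: "codeg d V x + 1 < card V" using deg by (simp add: codeg2_def)
  obtain y where "y \<in> V" "y \<noteq> x" "{x, y} \<in> d"
    using obtain_neighbour[of V "{}" x d] V one by auto
  moreover obtain u where "u \<in> V" "u \<notin> {y}" "u \<noteq> x" "{x, u} \<in> c"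
    using obtain_neighbour[of V "{y}" x c] V True \<open>y \<noteq> x\<close> by auto
  ultimately show ?thesis using V that[of u y] by (simp add: path3_def insert_commute)
next
  case False
  have one: "codeg c V x + 1 < card V" using deg by (simp add: codeg2_def)
  have two: "codeg d V x + 2 < card V" using deg False V(2) unfolding codeg2_def by linarith
  obtain u where "u \<in> V" "u \<noteq> x" "{x, u} \<in> c"
    using obtain_neighbour[of V "{}" x c] V one by auto
  moreover obtain y where "y \<in> V" "y \<notin> {u}" "y \<noteq> x" "{x, y} \<in> d"
    using obtain_neighbour[of V "{u}" x d] V two \<open>u \<noteq> x\<close> by auto
  ultimately show ?thesis using V that[of u y] by (simp add: path3_def insert_commute)
qed

lemma obtain_max_codeg2:
  assumes "finite V" "V \<noteq> {}"
  obtains x where "x \<in> V" "\<And>v. v \<in> V \<Longrightarrow> codeg2 c d V v \<le> codeg2 c d V x"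
    "2 * miss2 c d V \<le> codeg2 c d V x * card V"
proof -
  obtain x where x: "x \<in> V" "\<And>v. v \<in> V \<Longrightarrow> codeg2 c d V v \<le> codeg2 c d V x"
    using assms obtains_MAX[OF assms, of "codeg2 c d V"] by (metis Max_ge finite_imageI imageI)
  moreover have "2 * miss2 c d V \<le> codeg2 c d V x * card V"
    using sum_bounded_above[of V "codeg2 c d V" "codeg2 c d V x"] x sum_codeg2[OF assms(1), of c d]
    by (simp add: mult.commute)
  ultimately show ?thesis using that by blast
qed

text \<open>
  The middle vertex \<open>x\<close> has maximal codegree \<open>T\<close>; at least \<open>card V - 1 - T\<close> vertices are
  joined to it in both colours, and if one of them has codegree greater than \<open>2 (k - T - 1)\<close> then it
  is used as the end of the path where it contributes at least half of that.
\<close>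

lemma ex_heavy_path3:
  assumes V: "finite V" "V \<noteq> {}"
    and ex: "\<And>x. x \<in> V \<Longrightarrow> \<exists>u y. path3 c d V u x y"
    and sel: "\<And>T i. k = T + 1 + i \<Longrightarrow> T * card V < 2 * miss2 c d V \<or>
      T + 3 \<le> card V \<and> T * (T + 1) + 2 * i * (card V - 1 - T) < 2 * miss2 c d V"
  obtains u x y where "path3 c d V u x y" "k \<le> weight c d V u x y"
proof -
  obtain x where x: "x \<in> V" "\<And>v. v \<in> V \<Longrightarrow> codeg2 c d V v \<le> codeg2 c d V x"
    "2 * miss2 c d V \<le> codeg2 c d V x * card V"
    using obtain_max_codeg2[OF V] by blast
  define T where "T = codeg2 c d V x"
  show thesis
  proof (cases "T < k")
    case False
    obtain u y where "path3 c d V u x y" using ex[OF x(1)] by blast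
    moreover have "k \<le> weight c d V u x y" using False by (simp add: weight_def T_def)
    ultimately show ?thesis by (rule that)
  next
    case True
    then obtain i where i: "k = T + 1 + i"
      by (auto simp: less_iff_Suc_add)
    \<comment> \<open>By \<open>x(3)\<close> the maximum \<open>T\<close> is at least the average,
      which excludes the first alternative of \<open>sel\<close>.\<close>
    with sel[OF this] x(3) have T: "T + 3 \<le> card V"
      and big: "T * (T + 1) + 2 * i * (card V - 1 - T) < 2 * miss2 c d V"
      by (auto simp: T_def)
    let ?P = "V - ({x} \<union> (nonadj c V x \<union> nonadj d V x))"
    have "card ({x} \<union> (nonadj c V x \<union> nonadj d V x)) \<le> 1 + T"
      using card_Un_le[of "{x}" "nonadj c V x \<union> nonadj d V x"] card_Un_le[of "nonadj c V x" "nonadj d V x"]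
      by (simp add: T_def codeg2_def codeg_def)
    then have "card V - 1 - T \<le> card ?P"
      using diff_card_le_card_Diff[of "{x} \<union> (nonadj c V x \<union> nonadj d V x)" V] V
      by (simp add: finite_nonadj)
    then obtain P where P: "P \<subseteq> ?P" "card P = card V - 1 - T"
      by (rule obtain_subset_with_card_n)
    have PV: "P \<subseteq> V" "finite P" using P V finite_subset[of P V] by auto
    \<comment> \<open>Otherwise the vertices of \<open>P\<close> contribute at most
      \<open>2 * i\<close> each and the other \<open>T + 1\<close> at most \<open>T\<close> each,
      contradicting \<open>big\<close>.\<close>
    have "\<exists>p\<in>P. 2 * i < codeg2 c d V p"
    proof (rule ccontr)
      assume "\<not> ?thesis"
      then have "(\<Sum>v\<in>P. codeg2 c d V v) \<le> (2 * i) * (card V - 1 - T)"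
        using sum_bounded_above[of P "codeg2 c d V" "2 * i"] P(2)
        by (simp add: not_less mult.commute)
      moreover have "card (V - P) = T + 1"
        using P(2) PV T V by (simp add: card_Diff_subset)
      then have "(\<Sum>v\<in>V - P. codeg2 c d V v) \<le> T * (T + 1)"
        using sum_bounded_above[of "V - P" "codeg2 c d V" T] x(2) by (simp add: T_def mult.commute)
      moreover have "2 * miss2 c d V = (\<Sum>v\<in>V - P. codeg2 c d V v) + (\<Sum>v\<in>P. codeg2 c d V v)"
        using sum.subset_diff[OF PV(1) V(1), of "codeg2 c d V"] sum_codeg2[OF V(1), of c d] by linarith
      ultimately show False using big by linarith
    qed
    then obtain p where p: "p \<in> P" "2 * i < codeg2 c d V p" by blast
    have "card (P - {p}) \<noteq> 0" using P(2) T p PV by simp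
    then have "P - {p} \<noteq> {}" by (metis card.empty)
    then obtain p' where p': "p' \<in> P" "p' \<noteq> p" by blast
    have adj: "v \<in> V" "v \<noteq> x" "{x, v} \<in> c" "{x, v} \<in> d" if "v \<in> P" for v
      using that P(1) by (auto simp: nonadj_def)
    show ?thesis
    \<comment> \<open>Here \<open>k - T = i + 1\<close>, so one colour carries at least
      \<open>k - T\<close> of the codegree of \<open>p\<close>; this decides which end
      \<open>p\<close> becomes.\<close>
    proof (cases "k - T \<le> codeg c V p")
      case True
      have "path3 c d V p x p'"
        using adj[OF p(1)] adj[OF p'(1)] p'(2) x(1) by (auto simp: path3_def insert_commute)
      moreover have "k \<le> weight c d V p x p'" using True by (simp add: weight_def T_def)
      ultimately show ?thesis by (rule that)
    next
      case False
      have "path3 c d V p' x p"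
        using adj[OF p(1)] adj[OF p'(1)] p'(2) x(1) by (auto simp: path3_def insert_commute)
      moreover have "k - T \<le> codeg d V p"
        using False p(2) i by (simp add: codeg2_def)
      then have "k \<le> weight c d V p' x p" by (simp add: weight_def T_def)
      ultimately show ?thesis by (rule that)
    qed
  qed
qed

subsection \<open>The bound without a degree condition\<close>

text \<open>
  The special values for small odd \<open>n\<close> are \<open>((n + 3) div 2 choose 2) - 1\<close>: with one more missing
  edge, one colour may be absent from a set of \<open>(n + 3) div 2\<close> vertices, which is 3 more than the
  rest, whereas in a path on an odd number of vertices only one vertex is unmatched in that colour.
\<close>

definition odd_limit :: "nat \<Rightarrow> nat" where
  "odd_limit n = (if n = 3 then 2 else if n = 5 then 5 else if n = 7 then 9 else 2 * n - 4)"

text \<open>This is hypothesis \<open>sel\<close> of \<open>ex_heavy_path3\<close>, with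
  \<open>k\<close> the drop needed to get under the limit for \<open>n - 2\<close>. For
  \<open>n \<ge> 11\<close> the drop is at most 4, so few values of \<open>T\<close> remain.\<close>

lemma odd_limit_selection:
  assumes n: "odd n" "n \<ge> 5" and M: "M \<le> odd_limit n" and k: "M - odd_limit (n - 2) = T + 1 + i"
  shows "T * n < 2 * M \<or> T + 3 \<le> n \<and> T * (T + 1) + 2 * i * (n - 1 - T) < 2 * M"
proof -
  have eq: "M = odd_limit (n - 2) + T + 1 + i" using k by simp
  have "n = 5 \<or> n = 7 \<or> n = 9 \<or> n \<ge> 11"
    using n by presburger
  then consider "n = 5 \<or> n = 7 \<or> n = 9" | l where "n = l + 11"
    by (metis add.commute le_Suc_ex)
  then show ?thesis
  proof cases
    case 1
    then have "T < 5" using eq M by (auto simp: odd_limit_def)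
    then have "T = 0 \<or> T = 1 \<or> T = 2 \<or> T = 3 \<or> T = 4" by linarith
    with 1 show ?thesis
      using eq M by (elim disjE) (simp_all add: odd_limit_def, linarith?)
  next
    case l: 2
    then have "T < 4" using eq M by (simp add: odd_limit_def)
    then have "T = 0 \<or> T = 1 \<or> T = 2 \<or> T = 3" by linarith
    then show ?thesis
      using eq M l by (elim disjE) (simp_all add: odd_limit_def)
  qed
qed

lemma ham_odd:
  assumes "finite V" "odd (card V)" "card V \<ge> 3" "miss2 c d V \<le> odd_limit (card V)"
  shows "ham c d V"
  using assms
proof (induction "card V" arbitrary: V d rule: less_induct)
  case less
  note V = \<open>finite V\<close>
  define n where "n = card V"
  define M where "M = miss2 c d V"
  have n: "odd n" "n \<ge> 3" and M: "M \<le> odd_limit n"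
    using less.prems by (simp_all add: n_def M_def)
  have "V \<noteq> {}" using n by (auto simp: n_def)
  have lim: "odd_limit n \<le> 2 * n - 4" using n by (auto simp: odd_limit_def)
  have deletion: ?case if x: "x \<in> V" "codeg2 c d V x < 2 * (n - 1)" "M < n - 2 + codeg2 c d V x" for x
  proof -
    have "\<exists>e\<in>{c, d}. codeg e V x + card (insert x {}) < card V"
      using x(2) n by (auto simp: codeg2_def n_def)
    then obtain e where e: "e = c \<or> e = d" "codeg e V x + card (insert x {}) < card V" by blast
    obtain z where "z \<in> V" "z \<notin> {}" "z \<noteq> x" "{x, z} \<in> e"
      using obtain_neighbour[OF V _ x(1) e(2)] by auto
    then show ?thesis
      using ham_odd_by_deletion[of V x z c d] V n x e(1) by (auto simp: n_def M_def)
  qed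
  show ?case
  proof (cases "n = 3")
    case True
    \<comment> \<open>With at most two missing pairs on three vertices, averaging gives codegree at
      least \<open>M\<close>.\<close>
    obtain x where x: "x \<in> V" "2 * M \<le> codeg2 c d V x * n"
      using obtain_max_codeg2[OF V \<open>V \<noteq> {}\<close>, of c d] by (auto simp: n_def M_def)
    have "codeg2 c d V x \<le> M"
      using miss2_remove[OF V x(1), of c d] by (simp add: M_def)
    then show ?thesis
      using deletion[OF x(1)] x(2) M True by (simp add: odd_limit_def)
  next
    case False
    then have n5: "n \<ge> 5" using n by presburger
    show ?thesis
    proof (cases "\<forall>x\<in>V. \<exists>u y. path3 c d V u x y")
      case True
      obtain u x y where p: "path3 c d V u x y" and w: "M - odd_limit (n - 2) \<le> weight c d V u x y"
        using ex_heavy_path3[OF V \<open>V \<noteq> {}\<close>, where k = "M - odd_limit (n - 2)" and c = c and d = d]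
          odd_limit_selection[OF n(1) n5 M] True by (auto simp: n_def M_def)
      have card: "card (V - {u, x}) = n - 2" using card_contract[OF V p] by (simp add: n_def)
      have "ham c (redirect y u d) (V - {u, x})"
      proof (rule less.hyps)
        show "miss2 c (redirect y u d) (V - {u, x}) \<le> odd_limit (card (V - {u, x}))"
          using miss2_contract[OF V p] w unfolding card by (simp add: M_def)
      qed (use card n n5 V in \<open>auto simp: n_def\<close>)
      then show ?thesis by (rule ham_contract[OF p])
    next
      case False
      then obtain x where x: "x \<in> V" "\<nexists>u y. path3 c d V u x y" by blast
      \<comment> \<open>Not being the middle of a path forces a codegree so large that, with
        \<open>M \<le> 2 * n - 4\<close>, the vertex can be deleted.\<close>
      then have "codeg2 c d V x \<ge> n - 1"
        using ex_path3[OF V, of x c d] n by (force simp: n_def)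
      moreover have "codeg2 c d V x \<le> M"
        using miss2_remove[OF V x(1), of c d] by (simp add: M_def)
      ultimately show ?thesis
        using deletion[OF x(1)] M lim n5 by simp
    qed
  qed
qed

definition limit :: "nat \<Rightarrow> nat" where
  "limit n = (if even n then 2 * n - 3 else odd_limit n)"

lemma ham_limit:
  assumes "finite V" "card V \<ge> 2" "miss2 c d V \<le> limit (card V)"
  shows "ham c d V"
proof (cases "even (card V)")
  case True
  moreover have "V \<noteq> {}" using assms(2) by auto
  ultimately show ?thesis using assms ham_even[of V c d] by (simp add: limit_def)
next
  case False
  moreover from this have "card V \<ge> 3" using assms(2) by presburger
  ultimately show ?thesis using assms ham_odd[of V c d] by (simp add: limit_def)
qed

section \<open>Vertices of small degree\<close>

lemma codeg_0D: "finite V \<Longrightarrow> codeg c V v = 0 \<Longrightarrow> w \<in> V \<Longrightarrow> w \<noteq> v \<Longrightarrow> {v, w} \<in> c"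
  by (auto simp: codeg_def finite_nonadj) (auto simp: nonadj_def)

text \<open>Every vertex has at least three neighbours, so one survives the deletion of two.\<close>

lemma no_isolated_remove2:
  assumes V: "finite V" "card V \<ge> 4" and deg: "\<And>v. v \<in> V \<Longrightarrow> codeg c V v \<le> card V - 4"
  shows "no_isolated c (V - {a, b})"
  unfolding no_isolated_def
proof
  fix v assume v: "v \<in> V - {a, b}"
  have "card (insert v {a, b}) \<le> 3" using card_insert_le_m1 by (simp add: card_insert_if)
  then have "codeg c V v + card (insert v {a, b}) < card V"
    using deg[of v] v V(2) by auto
  from obtain_neighbour[OF V(1) _ _ this] v obtain z where
    "z \<in> V" "z \<notin> {a, b}" "z \<noteq> v" "{v, z} \<in> c" by auto
  then show "\<exists>z\<in>V - {a, b} - {v}. {v, z} \<in> c" by auto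
qed

text \<open>Without a path \<open>u x y\<close> the vertex \<open>x\<close> has the same single neighbour in both colours.\<close>

lemma ham_double_pendant:
  assumes V: "finite V" "card V \<ge> 6" and iso: "no_isolated c V" "no_isolated d V"
    and x: "x \<in> V" "\<nexists>u y. path3 c d V u x y" and M: "miss2 c d V \<le> 3 * card V - 10"
  shows "ham c d V"
proof -
  define n where "n = card V"
  obtain u where u: "u \<in> V" "u \<noteq> x" "{x, u} \<in> c" using iso(1) x(1) by (auto simp: no_isolated_def)
  obtain y where y: "y \<in> V" "y \<noteq> x" "{x, y} \<in> d" using iso(2) x(1) by (auto simp: no_isolated_def)
  have [simp]: "y = u" using x u y unfolding path3_def by (metis insert_commute)
  have sub: "V - {x, u} \<subseteq> nonadj c V x" "V - {x, u} \<subseteq> nonadj d V x"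
    using x u y unfolding nonadj_def path3_def by (auto simp: insert_commute)
  have "card (V - {x, u}) = n - 2" using V x u by (simp add: card_Diff_subset n_def)
  then have "codeg c V x \<ge> n - 2" "codeg d V x \<ge> n - 2"
    using card_mono[OF finite_nonadj[OF V(1)] sub(1)] card_mono[OF finite_nonadj[OF V(1)] sub(2)]
    by (simp_all add: codeg_def)
  then have deg: "codeg2 c d V x \<ge> 2 * n - 4" by (simp add: codeg2_def)
  show ?thesis
  proof (cases "odd n")
    case True
    then show ?thesis
      using ham_odd_by_deletion[of V x u c d] V x(1) u M deg by (auto simp: n_def)
  next
    case False
    \<comment> \<open>For even order both \<open>x\<close> and \<open>u\<close> are deleted; the
      cycle on the rest is entered by the \<open>d\<close>-edge \<open>x u\<close> and a
      \<open>c\<close>-edge from \<open>u\<close>.\<close>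
    have less: "miss2 c d (V - {x}) \<le> n - 6"
      using miss2_remove[OF V(1) x(1), of c d] M deg V(2) by (simp add: n_def)
    have uV: "u \<in> V - {x}" using u by simp
    have "codeg c (V - {x}) u \<le> n - 6"
      using miss2_remove[OF _ uV, of c d] V less by (simp add: codeg2_def)
    then have "codeg c (V - {x}) u + card (insert u {}) < card (V - {x})"
      using V x by (simp add: n_def)
    from obtain_neighbour[OF _ _ uV this] V obtain v where
      v: "v \<in> V - {x}" "v \<noteq> u" "{u, v} \<in> c" by auto
    have "miss2 d c (V - {x, u}) \<le> n - 6"
      using miss2_remove[OF _ uV, of c d] V less by (simp add: miss2_commute[of d] Diff_insert2[symmetric])
    moreover have cd: "card (V - {x, u}) = n - 2" using V x u by (simp add: card_Diff_subset n_def)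
    ultimately have "miss2 d c (V - {x, u}) < card (V - {x, u}) - 1"
      using V(2) by (simp add: n_def)
    moreover have "even (card (V - {x, u}))" using False cd by simp
    ultimately obtain xs where xs: "distinct xs" "set xs = V - {x, u}" "hd xs = v" "alt d c xs"
      using alt_cycle_from[of "V - {x, u}" v d c] V v by auto
    have "xs \<noteq> []" using xs(2) v by (metis DiffI Diff_iff empty_iff insert_iff list.set(1))
    then have "alt d c (x # u # xs)" using xs v y(3) by (simp add: alt_Cons)
    moreover have "distinct (x # u # xs)" "set (x # u # xs) = V" using xs x(1) u by auto
    ultimately show ?thesis unfolding ham_def by blast
  qed
qed

text \<open>Deleting both \<open>c\<close>-neighbours of \<open>z\<close> would isolate it, so the
  path is centred at \<open>z\<close>. Since \<open>codeg c V z\<close> already exhausts the weight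
  bound, all other terms vanish: both \<open>c\<close>-neighbours are joined to everything in
  \<open>c\<close>, and only pairs at \<open>z\<close> could be missing in \<open>d\<close>, where
  \<open>z\<close> too is complete.\<close>

lemma ex_path3_degree_2:
  assumes V: "finite V" "card V \<ge> 4" and z: "z \<in> V" "codeg c V z = card V - 3"
    and ex: "\<exists>u y. path3 c d V u z y"
    and light: "\<And>u x y. path3 c d V u x y \<Longrightarrow> weight c d V u x y \<le> card V - 3"
  obtains u y where "path3 c d V u z y" "no_isolated c (V - {u, z})" "no_isolated d (V - {z, y})"
proof -
  have "codeg d V z = 0"
    using ex light z by (fastforce simp: weight_def codeg2_def)
  then have zd: "{z, y} \<in> d" if "y \<in> V" "y \<noteq> z" for y using that codeg_0D V by metis
  have full: "codeg c V u = 0 \<and> codeg d V y = 0"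
    if "u \<in> V" "u \<noteq> z" "{z, u} \<in> c" "y \<in> V" "y \<noteq> z" "y \<noteq> u" for u y
  proof -
    have "path3 c d V u z y" using that zd z by (simp add: path3_def insert_commute)
    then show ?thesis using light z by (fastforce simp: weight_def codeg2_def)
  qed
  have "codeg c V z + card (insert z {}) < card V" using V(2) z(2) by simp
  then obtain u1 where u1: "u1 \<in> V" "u1 \<noteq> z" "{z, u1} \<in> c"
    using obtain_neighbour[of V "{}" z c] V(1) z(1) by auto
  have "codeg c V z + card (insert z {u1}) < card V" using V(2) z(2) u1(2) by simp
  then obtain u2 where u2: "u2 \<in> V" "u2 \<noteq> z" "u2 \<noteq> u1" "{z, u2} \<in> c"
    using obtain_neighbour[of V "{u1}" z c] V(1) z(1) by auto
  have "card {z, u1, u2} = 3" using u1 u2 by simp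
  then have "\<not> V \<subseteq> {z, u1, u2}"
    using V(2) card_mono[of "{z, u1, u2}" V] by auto
  then obtain y where y: "y \<in> V" "y \<noteq> z" "y \<noteq> u1" "y \<noteq> u2" by blast
  have c2: "{u2, v} \<in> c" if "v \<in> V" "v \<noteq> u2" for v
    using that full[of u2 y] u2 y codeg_0D[OF V(1)] by metis
  \<comment> \<open>The path used runs from whichever of \<open>u1\<close>, \<open>u2\<close>
    differs from \<open>v\<close>, through \<open>z\<close>, to \<open>v\<close>.\<close>
  have dall: "{v, w} \<in> d" if "v \<in> V" "w \<in> V" "v \<noteq> z" "v \<noteq> w" for v w
    using that full[of u1 v] full[of u2 v] u1 u2 codeg_0D[OF V(1)] by metis
  have "path3 c d V u1 z y" using u1 y z zd by (simp add: path3_def insert_commute)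
  moreover have "no_isolated c (V - {u1, z})"
    unfolding no_isolated_def
  proof
    fix v assume v: "v \<in> V - {u1, z}"
    show "\<exists>w\<in>V - {u1, z} - {v}. {v, w} \<in> c"
    proof (cases "v = u2")
      case True
      then show ?thesis using c2[of y] y by auto
    next
      case False
      then show ?thesis using c2[of v] u2 v by (auto simp: insert_commute)
    qed
  qed
  moreover have "no_isolated d (V - {z, y})"
    unfolding no_isolated_def
  proof
    fix v assume v: "v \<in> V - {z, y}"
    show "\<exists>w\<in>V - {z, y} - {v}. {v, w} \<in> d"
      using dall[of v u1] dall[of v u2] v u1 u2 y by (cases "v = u1") auto
  qed
  ultimately show ?thesis by (rule that)
qed

text \<open>
  The values at 9, 11 and 13 are again \<open>((n + 3) div 2 choose 2) - 1\<close>; the value at 6 is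
  \<open>limit 6\<close>, where the induction starts.
\<close>

definition mindeg_limit :: "nat \<Rightarrow> nat" where
  "mindeg_limit n =
    (if n = 6 then 9 else if n = 9 then 14 else if n = 11 then 20 else if n = 13 then 27 else 3 * n - 10)"

text \<open>The analogous check of \<open>sel\<close>. The required drop is at most 6 for
  \<open>n \<ge> 16\<close> and reaches 8 at \<open>n = 15\<close>, because of the smaller limit at
  13.\<close>

lemma mindeg_limit_selection:
  assumes n: "n \<ge> 8" "n \<noteq> 9" and M: "limit n < M" "M \<le> mindeg_limit n"
    and k: "M - mindeg_limit (n - 2) = T + 1 + i"
  shows "T * n < 2 * M \<or> T + 3 \<le> n \<and> T * (T + 1) + 2 * i * (n - 1 - T) < 2 * M"
proof -
  have eq: "M = mindeg_limit (n - 2) + T + 1 + i" using k by simp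
  note defs = mindeg_limit_def limit_def odd_limit_def
  have "n = 8 \<or> n = 10 \<or> n = 11 \<or> n = 12 \<or> n = 13 \<or> n = 14 \<or> n = 15 \<or> n \<ge> 16"
    using n by presburger
  then consider "n = 8 \<or> n = 10 \<or> n = 11 \<or> n = 12 \<or> n = 13 \<or> n = 14 \<or> n = 15" | l where "n = l + 16"
    by (metis add.commute le_Suc_ex)
  then show ?thesis
  proof cases
    case 1
    then have "T < 8" using eq M by (auto simp: defs)
    then have "T = 0 \<or> T = 1 \<or> T = 2 \<or> T = 3 \<or> T = 4 \<or> T = 5 \<or> T = 6 \<or> T = 7" by linarith
    with 1 show ?thesis
      using eq M by (elim disjE) (simp_all add: defs, linarith?)
  next
    case l: 2
    then have "T < 6" using eq M by (simp add: defs)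
    then have "T = 0 \<or> T = 1 \<or> T = 2 \<or> T = 3 \<or> T = 4 \<or> T = 5" by linarith
    then show ?thesis
      using eq M l by (elim disjE) (simp_all add: defs, presburger?)
  qed
qed

subsection \<open>The main induction\<close>

lemma ham_mindeg:
  assumes "finite V" "card V \<ge> 6" "card V \<noteq> 7" "no_isolated c V" "no_isolated d V"
    "miss2 c d V \<le> mindeg_limit (card V)"
  shows "ham c d V"
  using assms
proof (induction "card V" arbitrary: V c d rule: less_induct)
  case less
  note V = \<open>finite V\<close>
  define n where "n = card V"
  define M where "M = miss2 c d V"
  have M: "M \<le> mindeg_limit n" using less.prems by (simp add: n_def M_def)
  \<comment> \<open>The names \<open>c'\<close> and \<open>d'\<close> allow the two colours in
    either order.\<close>
  have IH: "ham c' d' V" if p: "path3 c' d' V u x y" and eq: "ham c' d' V \<longleftrightarrow> ham c d V" "miss2 c' d' V = M"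
    and iso: "no_isolated c' (V - {u, x})" "no_isolated d' (V - {x, y})"
    and w: "M - mindeg_limit (n - 2) \<le> weight c' d' V u x y" and n: "n \<ge> 8" "n \<noteq> 9" for c' d' u x y
  proof -
    have card: "card (V - {u, x}) = n - 2" using card_contract[OF V p] by (simp add: n_def)
    have "ham c' (redirect y u d') (V - {u, x})"
    proof (rule less.hyps)
      show "miss2 c' (redirect y u d') (V - {u, x}) \<le> mindeg_limit (card (V - {u, x}))"
        using miss2_contract[OF V p] w eq(2) unfolding card by simp
      show "no_isolated (redirect y u d') (V - {u, x})"
        by (rule no_isolated_contract[OF p iso(2)])
    qed (use card n V iso in \<open>auto simp: n_def\<close>)
    then show ?thesis by (rule ham_contract[OF p])
  qed
  show ?case
  proof (cases "M \<le> limit n")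
    case True
    then show ?thesis using ham_limit[OF V] less.prems(2) by (simp add: n_def M_def)
  next
    case nlim: False
    \<comment> \<open>At 6 and 9 both limits agree, so these orders are settled; hence contraction
      never leads to the excluded order 7.\<close>
    have n: "n \<ge> 8" "n \<noteq> 9"
    proof -
      have "n \<noteq> 6" "n \<noteq> 9"
        using nlim M by (auto simp: limit_def odd_limit_def mindeg_limit_def)
      then show "n \<ge> 8" "n \<noteq> 9" using less.prems(2,3) by (auto simp: n_def)
    qed
    have M3: "M \<le> 3 * n - 10"
      using M n by (auto simp: mindeg_limit_def split: if_splits)
    consider x where "x \<in> V" "\<nexists>u y. path3 c d V u x y"
      | u x y where "path3 c d V u x y" "M - limit (n - 2) \<le> weight c d V u x y"
      | "\<forall>x\<in>V. \<exists>u y. path3 c d V u x y"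
        "\<forall>u x y. path3 c d V u x y \<longrightarrow> weight c d V u x y < M - limit (n - 2)"
      by (meson not_le)
    then show ?thesis
    proof cases
      case 1
      then show ?thesis
        using ham_double_pendant[OF V _ less.prems(4,5)] less.prems(2) M3 by (simp add: n_def M_def)
    next
      case (2 u x y)
      have "ham c (redirect y u d) (V - {u, x})"
        using ham_limit[of "V - {u, x}" c "redirect y u d"] V n 2(2)
          miss2_contract[OF V 2(1)] card_contract[OF V 2(1)] by (simp add: n_def M_def)
      then show ?thesis by (rule ham_contract[OF 2(1)])
    next
      case 3
      \<comment> \<open>For even \<open>n\<close>, \<open>M - limit (n - 2)\<close> is at most
        \<open>(3 * n - 10) - (2 * n - 7) = n - 3\<close>; for odd \<open>n \<ge> 15\<close> it may
        be one more.\<close>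
      have light: "weight c d V u x y \<le> n - 3" "odd n \<and> n \<ge> 15 \<or> weight c d V u x y \<le> n - 4"
        if "path3 c d V u x y" for u x y
      proof -
        have "weight c d V u x y < M - limit (n - 2)" using 3(2) that by blast
        moreover have "n = 11 \<or> n = 13 \<or> n \<ge> 15 \<or> even n" using n by presburger
        ultimately show "weight c d V u x y \<le> n - 3" "odd n \<and> n \<ge> 15 \<or> weight c d V u x y \<le> n - 4"
          using M n unfolding limit_def odd_limit_def mindeg_limit_def
          by (auto split: if_splits)
      qed
      have light': "weight d c V u x y \<le> card V - 3" if "path3 d c V u x y" for u x y
        using light(1)[of y x u] that path3_commute weight_commute by (metis n_def)
      have codeg_le_weight: "codeg c V x \<le> weight c d V u x y" "codeg d V x \<le> weight c d V u x y" for u x y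
        by (simp_all add: weight_def codeg2_def)
      consider z where "z \<in> V" "codeg c V z = n - 3" "odd n" "n \<ge> 15"
        | z where "z \<in> V" "codeg d V z = n - 3" "odd n" "n \<ge> 15"
        | "\<forall>v\<in>V. codeg c V v \<le> n - 4 \<and> codeg d V v \<le> n - 4"
      proof -
        have "codeg c V v \<le> n - 4 \<or> odd n \<and> n \<ge> 15 \<and> codeg c V v = n - 3"
          "codeg d V v \<le> n - 4 \<or> odd n \<and> n \<ge> 15 \<and> codeg d V v = n - 3" if v: "v \<in> V" for v
        proof -
          obtain u y where "path3 c d V u v y" using 3(1) v by blast
          from light[OF this] codeg_le_weight[where x = v and u = u and y = y]
          show "codeg c V v \<le> n - 4 \<or> odd n \<and> n \<ge> 15 \<and> codeg c V v = n - 3"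
            "codeg d V v \<le> n - 4 \<or> odd n \<and> n \<ge> 15 \<and> codeg d V v = n - 3"
            by linarith+
        qed
        then show ?thesis using that by blast
      qed
      then show ?thesis
      proof cases
        case (1 z)
        obtain u y where p: "path3 c d V u z y" "no_isolated c (V - {u, z})" "no_isolated d (V - {z, y})"
          using ex_path3_degree_2[OF V _ 1(1), of c d] 1 3(1) light(1) n by (auto simp: n_def)
        have "M - mindeg_limit (n - 2) \<le> weight c d V u z y"
          \<comment> \<open>The weight is at least \<open>n - 3 \<ge> 12\<close>, whereas a drop of
            8 suffices.\<close>
          using codeg_le_weight(1)[of z u y] 1 M3 by (auto simp: mindeg_limit_def)
        then show ?thesis using IH[OF p(1) _ _ p(2,3)] n by (simp add: M_def)
      next
        case (2 z)
        have "\<exists>u y. path3 d c V u z y" using 3(1) 2(1) path3_commute by metis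
        then obtain u y where p: "path3 d c V u z y" "no_isolated d (V - {u, z})" "no_isolated c (V - {z, y})"
          using ex_path3_degree_2[OF V _ 2(1), of d c] 2 light' n by (auto simp: n_def)
        have "codeg d V z \<le> weight d c V u z y" by (simp add: weight_def codeg2_def)
        then have "M - mindeg_limit (n - 2) \<le> weight d c V u z y"
          using 2 M3 by (auto simp: mindeg_limit_def)
        then show ?thesis
          using IH[OF p(1) _ _ p(2,3)] n ham_commute[of c d V] miss2_commute[of c d V] by (simp add: M_def)
      next
        case deg: 3
        have "V \<noteq> {}" using n by (auto simp: n_def)
        obtain u x y where p: "path3 c d V u x y" and w: "M - mindeg_limit (n - 2) \<le> weight c d V u x y"
          using ex_heavy_path3[OF V \<open>V \<noteq> {}\<close>, where k = "M - mindeg_limit (n - 2)" and c = c and d = d]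
            mindeg_limit_selection[OF n _ M] nlim 3(1) by (auto simp: n_def M_def)
        show ?thesis
        proof (rule IH[OF p _ _ _ _ w n])
          show "no_isolated c (V - {u, x})" "no_isolated d (V - {x, y})"
            using deg n by (auto intro!: no_isolated_remove2 V simp: n_def)
        qed (simp_all add: M_def)
      qed
    qed
  qed
qed

section \<open>From the multigraph to its colour classes\<close>

definition colour_class :: "('v, 'e, 'c) ec_multigraph \<Rightarrow> 'c \<Rightarrow> 'v set set" where
  "colour_class G a = ends G ` {e \<in> edges G. colour G e = a}"

lemma (in edge_coloured_multigraph) card_colour_class:
  "card (colour_class G a) = card {e \<in> edges G. colour G e = a}"
  unfolding colour_class_def
  using parallel_colours by (intro card_image inj_onI) (metis (mono_tags, lifting) mem_Collect_eq)

lemma (in edge_coloured_multigraph) card_missing_colour_class: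
  "card (missing (colour_class G a) (vertices G)) + card (colour_class G a) = card (vertices G) choose 2"
proof -
  let ?K = "{e. e \<subseteq> vertices G \<and> card e = 2}"
  have sub: "colour_class G a \<subseteq> ?K"
    using ends_subset card_ends by (auto simp: colour_class_def)
  have fin: "finite ?K" using finite_vertices by simp
  have "missing (colour_class G a) (vertices G) = ?K - colour_class G a"
    by (auto simp: missing_def)
  then have "card (missing (colour_class G a) (vertices G)) = card ?K - card (colour_class G a)"
    using sub fin by (simp add: card_Diff_subset finite_subset)
  moreover have "card (colour_class G a) \<le> card ?K" by (rule card_mono[OF fin sub])
  ultimately show ?thesis using n_subsets[OF finite_vertices, of 2] by simp
qed

lemma proper_path_of_alt:
  assumes xs: "distinct xs" "set xs = vertices G" "xs \<noteq> []"
    and "p \<noteq> q" and alt: "alt (colour_class G p) (colour_class G q) xs"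
  shows "has_proper_hamiltonian_path G"
proof -
  define col where "col i = (if even i then p else q)" for i :: nat
  have "\<exists>e. e \<in> edges G \<and> colour G e = col i \<and> ends G e = {xs ! i, xs ! Suc i}" if "Suc i < length xs" for i
  proof -
    have "{xs ! i, xs ! Suc i} \<in> colour_class G (col i)"
      using alt that unfolding alt_nth col_def by (cases "even i") auto
    then show ?thesis unfolding colour_class_def by blast
  qed
  then obtain f where f: "\<And>i. Suc i < length xs \<Longrightarrow>
      f i \<in> edges G \<and> colour G (f i) = col i \<and> ends G (f i) = {xs ! i, xs ! Suc i}"
    by metis
  define es where "es = map f [0..<length xs - 1]"
  have "proper_path G xs es"
    unfolding proper_path_def is_path_def
    using xs f \<open>p \<noteq> q\<close> by (auto simp: es_def col_def)
  then show ?thesis using xs(2) unfolding has_proper_hamiltonian_path_def by blast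
qed

theorem theorem3p2:
  fixes G :: "('v, 'e, 'c) ec_multigraph" and r b :: 'c and n m :: nat
  assumes "edge_coloured_multigraph G {r, b}" and "r \<noteq> b"
    and "n = card (vertices G)" and "n \<ge> 14"
    and "m = card (edges G)"
    and "min_rainbow_degree G = 2"
    and "m \<ge> (n choose 2) + ((n - 3) choose 2) + 4"
  shows "has_proper_hamiltonian_path G"
proof -
  interpret edge_coloured_multigraph G "{r, b}" by (rule assms(1))
  let ?V = "vertices G" and ?R = "colour_class G r" and ?B = "colour_class G b"
  have iso: "no_isolated (colour_class G a) ?V" if a: "a \<in> {r, b}" for a
    unfolding no_isolated_def
  proof
    fix v assume v: "v \<in> ?V"
    let ?C = "colour G ` {e \<in> edges G. v \<in> ends G e}"
    have "2 \<le> rainbow_degree G v"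
      using assms(6) v finite_vertices unfolding min_rainbow_degree_def
      by (metis Min_le finite_imageI imageI)
    moreover have "?C \<subseteq> {r, b}" using colour_in by auto
    \<comment> \<open>With only two colours available, rainbow degree 2 means that both occur at
      \<open>v\<close>.\<close>
    ultimately have "?C = {r, b}"
      using card_subset_eq[of "{r, b}" ?C] card_mono[of "{r, b}" ?C] assms(2)
      by (simp add: rainbow_degree_def)
    then have "a \<in> ?C" using a by simp
    then obtain e where e: "e \<in> edges G" "v \<in> ends G e" "colour G e = a" by blast
    then obtain z where z: "ends G e = {v, z}" "z \<noteq> v"
      using card_ends[OF e(1)] by (metis card_2_iff doubleton_eq_iff insert_iff singletonD)
    then have "{v, z} \<in> colour_class G a" using e by (force simp: colour_class_def)
    moreover have "z \<in> ?V" using ends_subset[OF e(1)] z by simp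
    ultimately show "\<exists>z\<in>?V - {v}. {v, z} \<in> colour_class G a" using z by blast
  qed
  have "edges G = {e \<in> edges G. colour G e = r} \<union> {e \<in> edges G. colour G e = b}"
    using colour_in by auto
  then have "m = card ({e \<in> edges G. colour G e = r} \<union> {e \<in> edges G. colour G e = b})"
    using assms(5) by simp
  also have "\<dots> = card ?R + card ?B"
    using finite_edges assms(2) by (subst card_Un_disjoint) (auto simp: card_colour_class)
  finally have "miss2 ?R ?B ?V + m = 2 * (n choose 2)"
    using card_missing_colour_class[of r] card_missing_colour_class[of b] assms(3)
    by (simp add: miss2_def)
  \<comment> \<open>With the hypothesis on \<open>m\<close> this leaves at most
    \<open>3 * n - 6 - 4\<close> missing pairs, which is \<open>mindeg_limit n\<close> for
    \<open>n \<ge> 14\<close>.\<close>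
  moreover have "n choose 2 = ((n - 3) choose 2) + 3 * n - 6"
  proof -
    have "n = (n - 3) + 3" using assms(4) by simp
    then obtain l where "n = l + 3" by blast
    then show ?thesis by (simp add: eval_nat_numeral)
  qed
  ultimately have "miss2 ?R ?B ?V \<le> mindeg_limit n"
    using assms(4,7) by (simp add: mindeg_limit_def)
  then have "ham ?R ?B ?V"
    using ham_mindeg[OF finite_vertices _ _ iso iso] assms(3,4) by auto
  then obtain xs where xs: "distinct xs" "set xs = ?V" "alt ?R ?B xs \<or> alt ?B ?R xs"
    by (auto simp: ham_def)
  moreover have "xs \<noteq> []" using xs(2) assms(3,4) by auto
  ultimately show ?thesis using proper_path_of_alt[of xs G] assms(2) by metis
qed

end
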